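(* Let $N$ be a finite set with $|N|\geq 2$ and let $m\in\mathbb{R}^{\mathcal{P}(N)}$ with $m(\emptyset)=0$. Then the following conditions are equivalent: (i) $m$ is an exact game over $N$, that is, $m\in\mathcal{E}(N)$; (ii) for every semi-balanced set system $\mathcal{S}$ on $N$ one has $\langle\theta,m\rangle\geq 0$ for all $\theta\in\Theta_{\mathcal{S}}$; (iii) for every min-semi-balanced set system $\mathcal{S}$ on $N$ one has $\langle\theta_{\mathcal{S}},m\rangle\geq 0$.
   Context: $\mathcal{P}(N)$ is the power set of $N$, $\subset$ is strict inclusion, and $\chi_S\in\mathbb{R}^N$ is the incidence vector of $S\subseteq N$. A constant vector in $\mathbb{R}^N$ is a vector $[r,\ldots,r]$, $r\in\mathbb{R}$. A linear combination is affine if its coefficients sum to $1$, and semi-conic if at most one of its coefficients is strictly negative. Write $\langle\theta,m\rangle=\sum_{S\subseteq N}\theta(S)m(S)$. A non-trivial set system on $N$ is a system $\mathcal{S}$ with $\emptyset\neq\mathcal{S}\subseteq\mathcal{P}(N)\setminus\{\emptyset,N\}$. It is semi-balanced (on $N$) if some constant vector in $\mathbb{R}^N$ is a semi-conic combination of $\{\chi_S:S\in\mathcal{S}\}$ with all coefficients non-zero. It is min-semi-balanced if it is semi-balanced and no semi-balanced $\mathcal{C}\subset\mathcal{S}$ exists. For a non-trivial set system $\mathcal{S}$ on $N$, any affine semi-conic combination $\sum_{S\in\mathcal{S}}\lambda_S\chi_S$ (zero coefficients allowed) yielding a constant vector $[r,\ldots,r]$ is assigned the vector $\theta\in\mathbb{R}^{\mathcal{P}(N)}$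 with $\theta(S)=-\lambda_S$ for $S\in\mathcal{S}$, $\theta(N)=r$, $\theta(\emptyset)=1-r$, and $\theta(L)=0$ for other $L\subseteq N$. $\Theta_{\mathcal{S}}$ is the set of vectors $\theta$ for all such combinations. If $|\Theta_{\mathcal{S}}|=1$ (which holds whenever $\mathcal{S}$ is min-semi-balanced), its only element is denoted $\theta_{\mathcal{S}}$. A game over $N$ is $m\in\mathbb{R}^{\mathcal{P}(N)}$ with $m(\emptyset)=0$. Its core is $C(m)=\{x\in\mathbb{R}^N:\sum_{i\in N}x_i=m(N),\ \sum_{i\in S}x_i\geq m(S)\ \forall S\subseteq N\}$. The game $m$ is exact if for each $S\subseteq N$ there is $x\in C(m)$ with $\sum_{i\in S}x_i=m(S)$. $\mathcal{E}(N)$ is the set of exact games over $N$. *)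

theory Defs
  imports "HOL-Analysis.Analysis"
begin

text \<open>
  The ground set \<open>N\<close> is the universe of a finite type \<open>'n\<close>, so that \<open>\<real>\<^sup>N\<close> is \<open>real ^ 'n\<close>,
  the power set of \<open>N\<close> is the type \<open>'n set\<close>, the set \<open>N\<close> itself is \<open>UNIV\<close>, and the vectors
  indexed by the power set form \<open>real ^ ('n set)\<close>, with \<open>\<langle>\<theta>, m\<rangle>\<close> being \<open>\<theta> \<bullet> m\<close>.
  The constant vector \<open>[r, \<dots>, r]\<close> is \<open>vec r\<close>.
\<close>

definition incidence :: "'n set \<Rightarrow> real ^ 'n" where
  "incidence S = (\<chi> i. indicator S i)"

definition nontrivial_system :: "'n set set \<Rightarrow> bool" where
  "nontrivial_system \<S> \<longleftrightarrow> \<S> \<noteq> {} \<and> \<S> \<subseteq> UNIV - {{}, UNIV}"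

definition semi_conic :: "('n::finite) set set \<Rightarrow> ('n set \<Rightarrow> real) \<Rightarrow> bool" where
  "semi_conic \<S> l \<longleftrightarrow> card {S \<in> \<S>. l S < 0} \<le> 1"

definition affine_coeffs :: "('n::finite) set set \<Rightarrow> ('n set \<Rightarrow> real) \<Rightarrow> bool" where
  "affine_coeffs \<S> l \<longleftrightarrow> (\<Sum>S\<in>\<S>. l S) = 1"

definition semi_balanced :: "('n::finite) set set \<Rightarrow> bool" where
  "semi_balanced \<S> \<longleftrightarrow> nontrivial_system \<S> \<and>
     (\<exists>l r. semi_conic \<S> l \<and> (\<forall>S\<in>\<S>. l S \<noteq> 0) \<and>
            (\<Sum>S\<in>\<S>. l S *\<^sub>R incidence S) = vec r)"

definition min_semi_balanced :: "('n::finite) set set \<Rightarrow> bool" where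
  "min_semi_balanced \<S> \<longleftrightarrow> semi_balanced \<S> \<and> \<not> (\<exists>\<C>. \<C> \<subset> \<S> \<and> semi_balanced \<C>)"

text \<open>
  The cases in the next definition are disjoint for a non-trivial system \<open>\<S>\<close>; the function
  is only meant for such systems.
\<close>

definition theta_vec ::
    "('n::finite) set set \<Rightarrow> ('n set \<Rightarrow> real) \<Rightarrow> real \<Rightarrow> real ^ ('n set)" where
  "theta_vec \<S> l r =
     (\<chi> L. if L \<in> \<S> then - l L
           else if L = UNIV then r
           else if L = {} then 1 - r
           else 0)"

definition Theta :: "('n::finite) set set \<Rightarrow> (real ^ ('n set)) set" where
  "Theta \<S> = {theta_vec \<S> l r | l r.
     affine_coeffs \<S> l \<and> semi_conic \<S> l \<and> (\<Sum>S\<in>\<S>. l S *\<^sub>R incidence S) = vec r}"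

text \<open>
  Only meaningful if \<open>Theta \<S>\<close> is a singleton, which is the case for min-semi-balanced \<open>\<S>\<close>.
\<close>

definition theta :: "('n::finite) set set \<Rightarrow> real ^ ('n set)" where
  "theta \<S> = the_elem (Theta \<S>)"

definition game :: "real ^ (('n::finite) set) \<Rightarrow> bool" where
  "game m \<longleftrightarrow> m $ {} = 0"

definition core :: "real ^ (('n::finite) set) \<Rightarrow> (real ^ 'n) set" where
  "core m = {x. (\<Sum>i\<in>UNIV. x $ i) = m $ UNIV \<and> (\<forall>S. (\<Sum>i\<in>S. x $ i) \<ge> m $ S)}"

definition exact_games :: "(real ^ (('n::finite) set)) set" where
  "exact_games = {m. game m \<and> (\<forall>S. \<exists>x\<in>core m. (\<Sum>i\<in>S. x $ i) = m $ S)}"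

end

theory Submission
  imports Defs
begin

text \<open>
  Failure of exactness at a set \<open>T\<close> is infeasibility of a linear system; Farkas' lemma turns it
  into a semi-conic combination, negative at most at \<open>T\<close>, that equals a constant vector and pairs
  negatively with \<open>m\<close>.  A non-zero combination of this kind has positive coefficient sum, hence can
  be made affine.  If its support properly contains a semi-balanced system, subtracting a positive
  multiple of the corresponding combination cancels a coefficient and keeps the sign condition; by
  induction on the support, min-semi-balanced systems suffice.  The same subtraction shows that
  \<open>Theta\<close> is a singleton for them.
\<close>

text \<open>Coefficients are total functions on the power set, the system being their support, so
  that combinations over different systems can be subtracted. The only set allowed a negative
  coefficient is named; \<open>l T\<close> need not be negative, and for \<open>T = {}\<close> or
  \<open>T = UNIV\<close> all coefficients are nonnegative.\<close>

definition balanced_at :: "('n::finite) set \<Rightarrow> ('n set \<Rightarrow> real) \<Rightarrow> real \<Rightarrow> bool" where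
  "balanced_at T l r \<longleftrightarrow> l {} = 0 \<and> l UNIV = 0 \<and> (\<forall>S. S \<noteq> T \<longrightarrow> 0 \<le> l S) \<and>
     (\<Sum>S\<in>UNIV. l S *\<^sub>R incidence S) = vec r"

text \<open>The pairing of \<open>m\<close> with the vector assigned to \<open>(l, r)\<close>, apart
  from the entry at the empty set. It is linear in \<open>(l, r)\<close>, so it also makes sense for
  combinations that are not affine.\<close>

definition value_of :: "real ^ (('n::finite) set) \<Rightarrow> ('n set \<Rightarrow> real) \<Rightarrow> real \<Rightarrow> real" where
  "value_of m l r = r * m $ UNIV - (\<Sum>S\<in>UNIV. l S * m $ S)"

section \<open>Calculus of balanced combinations: positivity and support reduction\<close>

lemma balanced_atD:
  assumes "balanced_at T l r"
  shows "l {} = 0" "l UNIV = 0" "S \<noteq> T \<Longrightarrow> 0 \<le> l S"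
    "(\<Sum>S\<in>UNIV. l S *\<^sub>R incidence S) = vec r"
  using assms by (auto simp: balanced_at_def)

text \<open>Coordinate \<open>i\<close> of the vector equation; in particular \<open>l\<close>
  determines \<open>r\<close>.\<close>

lemma balanced_at_component:
  assumes "balanced_at T l r"
  shows "(\<Sum>S\<in>{S. i \<in> S}. l S) = r"
proof -
  have "(\<Sum>S\<in>UNIV. l S *\<^sub>R incidence S) $ i = (\<Sum>S\<in>UNIV. if i \<in> S then l S else 0)"
    unfolding sum_component by (intro sum.cong) (auto simp: incidence_def)
  also have "\<dots> = (\<Sum>S\<in>{S. i \<in> S}. l S)"
    by (simp add: sum.If_cases)
  finally show ?thesis
    using balanced_atD(4)[OF assms] by simp
qed

text \<open>The sign at \<open>T\<close> is free, so the inequality is required off \<open>T\<close>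
  only, and the exceptional set \<open>T'\<close> of \<open>k\<close> may differ from
  \<open>T\<close>.\<close>

lemma balanced_at_diff_scaled:
  assumes "balanced_at T l r" "balanced_at T' k r'" "\<And>S. S \<noteq> T \<Longrightarrow> t * k S \<le> l S"
  shows "balanced_at T (\<lambda>S. l S - t * k S) (r - t * r')"
proof -
  have "(\<Sum>S\<in>UNIV. (l S - t * k S) *\<^sub>R incidence S) =
      (\<Sum>S\<in>UNIV. l S *\<^sub>R incidence S) - t *\<^sub>R (\<Sum>S\<in>UNIV. k S *\<^sub>R incidence S)"
    by (simp add: scaleR_diff_left sum_subtractf scaleR_sum_right)
  also have "\<dots> = vec (r - t * r')"
    using assms by (auto simp: balanced_at_def vec_eq_iff)
  finally show ?thesis
    using assms by (auto simp: balanced_at_def)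
qed

lemma balanced_at_scale:
  assumes "balanced_at T l r" "0 \<le> c"
  shows "balanced_at T (\<lambda>S. c * l S) (c * r)"
proof -
  have "(\<Sum>S\<in>UNIV. (c * l S) *\<^sub>R incidence S) = c *\<^sub>R (\<Sum>S\<in>UNIV. l S *\<^sub>R incidence S)"
    by (simp add: scaleR_sum_right)
  then show ?thesis
    using assms by (auto simp: balanced_at_def vec_eq_iff)
qed

lemma value_of_diff_scaled:
  "value_of m (\<lambda>S. l S - t * k S) (r - t * r') = value_of m l r - t * value_of m k r'"
  by (simp add: value_of_def algebra_simps sum_subtractf sum_distrib_left)

lemma value_of_scale: "value_of m (\<lambda>S. c * l S) (c * r) = c * value_of m l r"
  by (simp add: value_of_def algebra_simps sum_distrib_left)

text \<open>The interesting case is \<open>l T < 0\<close>. A point outside \<open>T\<close> shows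
  \<open>0 \<le> r\<close>, and a point \<open>a\<close> of \<open>T\<close> splits the sum into
  \<open>r\<close> and the coefficients of sets avoiding \<open>a\<close>, which are nonnegative. A
  sum that is not positive thus forces both parts to vanish, and this kills every coefficient,
  including the one at \<open>T\<close>.\<close>

lemma balanced_at_sum_pos:
  assumes l: "balanced_at T l r" and nz: "l S0 \<noteq> 0"
  shows "0 < (\<Sum>S\<in>UNIV. l S)"
proof (rule ccontr)
  assume neg: "\<not> 0 < (\<Sum>S\<in>UNIV. l S)"
  show False
  proof (cases "0 \<le> l T")
    case True
    then have ge: "0 \<le> l S" for S
      using balanced_atD(3)[OF l] by (cases "S = T") auto
    with neg have "(\<Sum>S\<in>UNIV. l S) = 0"
      by (meson not_less order_antisym sum_nonneg)
    with ge nz show False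
      by (simp add: sum_nonneg_eq_0_iff)
  next
    case False
    \<comment> \<open>\<open>T\<close> is neither empty nor everything, since \<open>l\<close>
      vanishes at those two sets.\<close>
    then obtain i j where i: "i \<in> T" and j: "j \<notin> T"
      using balanced_atD(1,2)[OF l] by (metis UNIV_eq_I all_not_in_conv order_refl)
    have pj: "0 \<le> l S" if "j \<in> S" for S
      using balanced_atD(3)[OF l] j that by metis
    have r0: "0 \<le> r"
      using balanced_at_component[OF l, of j] pj by (metis mem_Collect_eq sum_nonneg)
    have split: "(\<Sum>S\<in>UNIV. l S) = r + (\<Sum>S\<in>{S. a \<notin> S}. l S)" for a
    proof -
      have "(\<Sum>S\<in>UNIV. l S) = (\<Sum>S\<in>{S. a \<in> S} \<union> {S. a \<notin> S}. l S)"
        by (rule sum.cong) auto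
      also have "\<dots> = r + (\<Sum>S\<in>{S. a \<notin> S}. l S)"
        by (subst sum.union_disjoint) (auto simp: balanced_at_component[OF l])
      finally show ?thesis .
    qed
    have ge: "0 \<le> (\<Sum>S\<in>{S. a \<notin> S}. l S)" if "a \<in> T" for a
      using balanced_atD(3)[OF l] that by (intro sum_nonneg) blast
    have rz: "r = 0 \<and> (\<Sum>S\<in>{S. a \<notin> S}. l S) = 0" if "a \<in> T" for a
      using r0 neg split[of a] ge[OF that] by linarith
    then have r: "r = 0"
      using i by blast
    \<comment> \<open>A set other than \<open>T\<close> either misses a point of \<open>T\<close>,
      and then occurs in a vanishing sum over sets avoiding that point, or contains a point outside
      \<open>T\<close>, and then occurs in a sum equal to \<open>r = 0\<close>. All terms of these
      sums are nonnegative.\<close>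
    have only: "l S = 0" if ne: "S \<noteq> T" for S
    proof -
      consider a where "a \<in> T" "a \<notin> S" | b where "b \<in> S" "b \<notin> T"
        using ne by blast
      then show ?thesis
      proof cases
        case 1
        then have "\<forall>U\<in>{U. a \<notin> U}. l U = 0"
          using conjunct2[OF rz[OF 1(1)]] balanced_atD(3)[OF l]
          by (subst (asm) sum_nonneg_eq_0_iff) auto
        with 1 show ?thesis by simp
      next
        case 2
        have "\<forall>U\<in>{U. b \<in> U}. l U = 0"
          using balanced_at_component[OF l, of b] balanced_atD(3)[OF l] r 2(2)
          by (intro sum_nonneg_eq_0_iff[THEN iffD1]) auto
        with 2 show ?thesis by simp
      qed
    qed
    have "r = (\<Sum>S\<in>{S. i \<in> S}. if S = T then l T else 0)"
      unfolding balanced_at_component[OF l, of i, symmetric] using only by (intro sum.cong) auto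
    also have "\<dots> = l T"
      using i by simp
    finally show False
      using r False by simp
  qed
qed

text \<open>A ratio test as in the simplex method: \<open>t\<close> is the largest factor for which
  \<open>l - t * k\<close> stays nonnegative off \<open>T\<close>, and a set attaining the minimal
  ratio leaves the support. The ratio is positive because the support of \<open>k\<close> lies in
  that of \<open>l\<close>.\<close>

lemma balanced_at_reduce:
  assumes l: "balanced_at T l r" and k: "balanced_at T' k r'"
    and sub: "{S. k S \<noteq> 0} \<subseteq> {S. l S \<noteq> 0}" and nz: "k S0 \<noteq> 0"
  obtains t where "0 < t" "balanced_at T (\<lambda>S. l S - t * k S) (r - t * r')"
    "{S. l S - t * k S \<noteq> 0} \<subset> {S. l S \<noteq> 0}"
proof -
  define P where "P = {S. S \<noteq> T \<and> 0 < k S}"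
  have "P \<noteq> {}"
  proof
    \<comment> \<open>otherwise both \<open>k\<close> and \<open>- k\<close> would have positive coefficient sum\<close>
    assume "P = {}"
    then have "\<And>S. S \<noteq> T \<Longrightarrow> k S \<le> 0"
      unfolding P_def using not_less by blast
    moreover have "balanced_at T (\<lambda>S. 0) 0"
      by (simp add: balanced_at_def)
    ultimately have "balanced_at T (\<lambda>S. 0 - 1 * k S) (0 - 1 * r')"
      using k by (intro balanced_at_diff_scaled) auto
    from balanced_at_sum_pos[OF this, of S0] balanced_at_sum_pos[OF k nz] nz show False
      by (simp add: sum_negf)
  qed
  moreover have "finite P" by simp
  ultimately obtain S1 where S1: "S1 \<in> P" "\<And>S. S \<in> P \<Longrightarrow> l S1 / k S1 \<le> l S / k S"
    using ex_min_if_finite[of "(\<lambda>S. l S / k S) ` P"] by (auto simp: not_less)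
  define t where "t = l S1 / k S1"
  have k1: "0 < k S1" "S1 \<noteq> T"
    using S1 by (auto simp: P_def)
  then have "l S1 > 0"
    using sub balanced_atD(3)[OF l, of S1] by force
  with k1 have t: "0 < t"
    by (simp add: t_def)
  have le: "t * k S \<le> l S" if "S \<noteq> T" for S
  proof (cases "0 < k S")
    case True
    with that S1(2)[of S] show ?thesis
      by (simp add: P_def t_def pos_le_divide_eq)
  next
    case False
    then have "t * k S \<le> 0"
      using t by (simp add: mult_le_0_iff)
    with balanced_atD(3)[OF l that] show ?thesis
      by linarith
  qed
  have "l S1 - t * k S1 = 0"
    using k1 by (simp add: t_def)
  moreover have "l S - t * k S = 0" if "l S = 0" for S
    using sub that by auto
  ultimately have "{S. l S - t * k S \<noteq> 0} \<subset> {S. l S \<noteq> 0}"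
    using \<open>l S1 > 0\<close> by (smt (verit) Collect_mono_iff mem_Collect_eq psubsetI)
  with t balanced_at_diff_scaled[OF l k le] show thesis
    by (rule that)
qed

section \<open>Exactness and linear duality\<close>

lemma incidence_inner: "incidence S \<bullet> x = (\<Sum>i\<in>S. x $ i)"
  by (simp add: inner_vec_def incidence_def indicator_def if_distrib[where f="\<lambda>c. c * _"]
      sum.If_cases cong: if_cong)

lemma vec_inner: "(vec r :: real ^ 'n) \<bullet> x = r * (\<Sum>i\<in>UNIV. x $ i)"
  by (simp add: inner_vec_def sum_distrib_left)

text \<open>Pairing the vector equation with a core element \<open>x\<close> that is tight at
  \<open>T\<close> writes the value as the sum of \<open>l S\<close> times the slack of
  \<open>x\<close> at \<open>S\<close>. The slacks are nonnegative, and the one at \<open>T\<close>,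
  where \<open>l\<close> may be negative, is zero.\<close>

lemma exact_value_nonneg:
  assumes m: "m \<in> exact_games" and l: "balanced_at T l r"
  shows "0 \<le> value_of m l r"
proof -
  obtain x where x: "x \<in> core m" "(\<Sum>i\<in>T. x $ i) = m $ T"
    using m by (auto simp: exact_games_def)
  have "(\<Sum>S\<in>UNIV. l S * (\<Sum>i\<in>S. x $ i)) = (\<Sum>S\<in>UNIV. l S *\<^sub>R incidence S) \<bullet> x"
    by (simp add: inner_sum_left incidence_inner)
  also have "\<dots> = r * m $ UNIV"
    using x by (simp add: balanced_atD(4)[OF l] vec_inner core_def)
  finally have "value_of m l r = (\<Sum>S\<in>UNIV. l S * ((\<Sum>i\<in>S. x $ i) - m $ S))"
    by (simp add: value_of_def algebra_simps sum_subtractf)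
  also have "\<dots> \<ge> 0"
  proof (rule sum_nonneg)
    fix S
    show "0 \<le> l S * ((\<Sum>i\<in>S. x $ i) - m $ S)"
      using x balanced_atD(3)[OF l, of S] by (cases "S = T") (auto simp: core_def)
  qed
  finally show ?thesis .
qed

text \<open>A finitely generated cone is polyhedral, hence closed, so \<open>z\<close> can be
  strictly separated from it. As the cone contains 0, the level \<open>b\<close> is negative; a
  generator with negative inner product could be scaled to reach level \<open>b\<close>
  exactly.\<close>

lemma Farkas_cone:
  fixes A :: "'a::euclidean_space set"
  assumes "finite A" "z \<notin> convex_cone hull A"
  obtains a where "a \<bullet> z < 0" "\<And>x. x \<in> A \<Longrightarrow> 0 \<le> a \<bullet> x"
proof -
  let ?K = "convex_cone hull A"
  have "closed ?K"
    using assms(1) by (intro polyhedron_imp_closed polyhedron_convex_cone_hull)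
  then obtain a b where ab: "a \<bullet> z < b" "\<And>x. x \<in> ?K \<Longrightarrow> b < a \<bullet> x"
    using separating_hyperplane_closed_point[OF convex_convex_cone_hull _ assms(2)] by blast
  have b: "b < 0"
    using ab(2)[OF convex_cone_hull_contains_0] by simp
  show thesis
  proof
    show "a \<bullet> z < 0"
      using ab b by simp
    fix x assume x: "x \<in> A"
    show "0 \<le> a \<bullet> x"
    proof (rule ccontr)
      assume neg: "\<not> 0 \<le> a \<bullet> x"
      then have "(b / (a \<bullet> x)) *\<^sub>R x \<in> ?K"
        using b x by (intro convex_cone_hull_mul hull_inc) (auto simp: divide_nonpos_neg)
      from ab(2)[OF this] neg show False
        by simp
    qed
  qed
qed

lemma not_exact_value_neg:
  fixes m :: "real ^ (('n::finite) set)"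
  assumes m0: "m $ {} = 0" and "m \<notin> exact_games"
  obtains T l r where "balanced_at T l r" "value_of m l r < 0"
proof -
  obtain T where T: "\<And>x. x \<in> core m \<Longrightarrow> (\<Sum>i\<in>T. x $ i) \<noteq> m $ T"
    using assms by (auto simp: exact_games_def game_def)
  \<comment> \<open>A core element tight at \<open>T\<close> solves the inequalities given by all
    \<open>g S\<close>, with equality at \<open>T\<close> and \<open>UNIV\<close>; the two negated
    generators encode the equalities.\<close>
  define g where "g S = (incidence S, m $ S)" for S
  define A where "A = range g \<union> {- g T, - g UNIV}"
  \<comment> \<open>An explicit description of combinations of the generators: the coefficient of
    \<open>g UNIV\<close> is stored as \<open>- r\<close>, that of \<open>g {}\<close> is dropped
    because \<open>g {} = 0\<close>, and the one at \<open>T\<close> has free sign. Membership of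
    \<open>(0, 1)\<close> means a balanced combination of value -1.\<close>
  define R where "R = {(v, c). \<exists>l r. l {} = 0 \<and> l UNIV = 0 \<and> (\<forall>S. S \<noteq> T \<longrightarrow> 0 \<le> l S) \<and>
    v = (\<Sum>S\<in>UNIV. l S *\<^sub>R incidence S) - vec r \<and> c = - value_of m l r}"
  have RI: "((\<Sum>S\<in>UNIV. l S *\<^sub>R incidence S) - vec r, - value_of m l r) \<in> R"
    if "\<forall>S. S \<noteq> T \<longrightarrow> 0 \<le> l S" "l {} = 0" "l UNIV = 0" for l r
    unfolding R_def using that by blast
  have RE: thesis
    if "p \<in> R" "\<And>l r. \<forall>S. S \<noteq> T \<longrightarrow> 0 \<le> l S \<Longrightarrow> l {} = 0 \<Longrightarrow> l UNIV = 0 \<Longrightarrow>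
      p = ((\<Sum>S\<in>UNIV. l S *\<^sub>R incidence S) - vec r, - value_of m l r) \<Longrightarrow> thesis" for p thesis
    using that unfolding R_def by blast
  have "(0, 1) \<in> convex_cone hull A"
  proof (rule ccontr)
    assume "(0, 1) \<notin> convex_cone hull A"
    then obtain a where a: "a \<bullet> (0, 1) < 0" "\<And>p. p \<in> A \<Longrightarrow> 0 \<le> a \<bullet> p"
      by (rule Farkas_cone[rotated]) (auto simp: A_def)
    obtain y c where yc: "a = (y, c)"
      by (cases a)
    \<comment> \<open>The separating functional has \<open>c < 0\<close>; with this scaling
      \<open>a\<close> equals \<open>- c\<close> times \<open>(x, - 1)\<close>, so its value at
      \<open>g S\<close> is a positive multiple of the slack of \<open>x\<close> at
      \<open>S\<close>.\<close>
    define x where "x = (1 / (- c)) *\<^sub>R y"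
    have c: "c < 0"
      using a(1) by (simp add: yc)
    have y: "y \<bullet> incidence S = (- c) * (\<Sum>i\<in>S. x $ i)" for S
      using c unfolding incidence_inner[symmetric] by (simp add: x_def inner_commute)
    have ag: "a \<bullet> g S = (- c) * ((\<Sum>i\<in>S. x $ i) - m $ S)" for S
      by (simp add: yc g_def y algebra_simps)
    have "0 \<le> a \<bullet> g S" for S
      by (rule a) (simp add: A_def)
    then have ge: "m $ S \<le> (\<Sum>i\<in>S. x $ i)" for S
      using c unfolding ag by (simp add: zero_le_mult_iff mult_le_0_iff)
    have "0 \<le> a \<bullet> (- g S)" if "S \<in> {T, UNIV}" for S
      using that by (intro a) (auto simp: A_def)
    then have "(\<Sum>i\<in>S. x $ i) \<le> m $ S" if "S \<in> {T, UNIV}" for S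
      using c that unfolding inner_minus_right ag by (simp add: zero_le_mult_iff mult_le_0_iff)
    with ge have "(\<Sum>i\<in>S. x $ i) = m $ S" if "S \<in> {T, UNIV}" for S
      using that by (simp add: order_antisym)
    then have "x \<in> core m" "(\<Sum>i\<in>T. x $ i) = m $ T"
      using ge by (auto simp: core_def)
    with T show False by blast
  qed
  moreover have "convex_cone hull A \<subseteq> R"
  proof (rule hull_minimal)
    \<comment> \<open>The value 1 for \<open>c\<close> gives the generators, -1 the two negated
      ones, and 0 the origin.\<close>
    have gen: "c *\<^sub>R g S \<in> R" if "0 \<le> c \<or> S = T \<or> S = UNIV" for c S
    proof -
      consider "S = {}" | "S = UNIV" | "S \<noteq> {}" "S \<noteq> UNIV" by blast
      then show ?thesis
      proof cases
        case 1
        then show ?thesis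
          unfolding R_def g_def using m0
          by (auto simp: incidence_def value_of_def vec_eq_iff intro!: exI[of _ "\<lambda>_. 0"] exI[of _ 0])
      next
        case 2
        then show ?thesis
          unfolding R_def g_def
          by (auto simp: incidence_def value_of_def vec_eq_iff intro!: exI[of _ "\<lambda>_. 0"] exI[of _ "- c"])
      next
        case 3
        have "(\<Sum>U\<in>UNIV. (if U = S then c else 0) *\<^sub>R incidence U) = c *\<^sub>R incidence S"
          by (subst sum.remove[of _ S]) auto
        moreover have "value_of m (\<lambda>U. if U = S then c else 0) 0 = - (c * m $ S)"
          unfolding value_of_def by (subst sum.remove[of _ S]) auto
        moreover have "0 \<le> (if U = S then c else 0)" if "U \<noteq> T" for U
          using that 3 \<open>0 \<le> c \<or> S = T \<or> S = UNIV\<close> by auto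
        moreover have "vec 0 = (0 :: real ^ 'n)"
          by (simp add: vec_eq_iff)
        ultimately show ?thesis
          unfolding R_def g_def using 3
          by (auto simp del: if_split intro!: exI[of _ "\<lambda>U. if U = S then c else 0"] exI[of _ 0])
      qed
    qed
    show "A \<subseteq> R"
      using gen[of 1] gen[of "-1"] by (auto simp: A_def)
    show "convex_cone R"
      unfolding convex_cone_iff
    proof (intro conjI ballI allI impI)
      show "0 \<in> R"
        using gen[of 0 T] by simp
      show "p + q \<in> R" if pq: "p \<in> R" "q \<in> R" for p q
      proof -
        obtain l r where l: "\<forall>S. S \<noteq> T \<longrightarrow> 0 \<le> l S" "l {} = 0" "l UNIV = 0"
          and p: "p = ((\<Sum>S\<in>UNIV. l S *\<^sub>R incidence S) - vec r, - value_of m l r)"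
          by (rule RE[OF pq(1)])
        obtain k s where k: "\<forall>S. S \<noteq> T \<longrightarrow> 0 \<le> k S" "k {} = 0" "k UNIV = 0"
          and q: "q = ((\<Sum>S\<in>UNIV. k S *\<^sub>R incidence S) - vec s, - value_of m k s)"
          by (rule RE[OF pq(2)])
        have "p + q = ((\<Sum>S\<in>UNIV. (l S + k S) *\<^sub>R incidence S) - vec (r + s),
            - value_of m (\<lambda>S. l S + k S) (r + s))"
          by (simp add: p q value_of_def algebra_simps sum.distrib vec_eq_iff)
        also have "\<dots> \<in> R"
          using l k by (intro RI) simp_all
        finally show ?thesis .
      qed
      show "c *\<^sub>R p \<in> R" if pc: "p \<in> R" "0 \<le> c" for p and c :: real
      proof -
        obtain l r where l: "\<forall>S. S \<noteq> T \<longrightarrow> 0 \<le> l S" "l {} = 0" "l UNIV = 0"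
          and p: "p = ((\<Sum>S\<in>UNIV. l S *\<^sub>R incidence S) - vec r, - value_of m l r)"
          by (rule RE[OF pc(1)])
        have "c *\<^sub>R p = ((\<Sum>S\<in>UNIV. (c * l S) *\<^sub>R incidence S) - vec (c * r),
            - value_of m (\<lambda>S. c * l S) (c * r))"
          by (simp add: p value_of_scale scaleR_diff_right scaleR_sum_right vec_eq_iff)
        also have "\<dots> \<in> R"
          using l pc(2) by (intro RI) simp_all
        finally show ?thesis .
      qed
    qed
  qed
  ultimately have "(0, 1) \<in> R"
    by blast
  then obtain l r where "\<forall>S. S \<noteq> T \<longrightarrow> 0 \<le> l S" "l {} = 0" "l UNIV = 0"
    "(0, 1) = ((\<Sum>S\<in>UNIV. l S *\<^sub>R incidence S) - vec r, - value_of m l r)"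
    by (rule RE)
  then show thesis
    by (intro that[of T l r]) (auto simp: balanced_at_def)
qed

section \<open>Set systems as supports of balanced combinations\<close>

lemma sum_extend_by_zero:
  fixes f :: "'a::finite \<Rightarrow> real" and h :: "'a \<Rightarrow> 'b::real_vector"
  shows "(\<Sum>S\<in>UNIV. (if S \<in> A then f S else 0) *\<^sub>R h S) = (\<Sum>S\<in>A. f S *\<^sub>R h S)"
  by (simp add: if_distrib[where f="\<lambda>c. c *\<^sub>R _"] sum.If_cases cong: if_cong)

text \<open>\<open>T\<close> is the set with negative coefficient if there is one, and arbitrary
  otherwise.\<close>

lemma semi_conic_imp_balanced_at:
  assumes nt: "nontrivial_system \<S>" and sc: "semi_conic \<S> l"
    and eq: "(\<Sum>S\<in>\<S>. l S *\<^sub>R incidence S) = vec r"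
  obtains T where "balanced_at T (\<lambda>S. if S \<in> \<S> then l S else 0) r"
proof -
  have "card {S \<in> \<S>. l S < 0} \<le> Suc 0"
    using sc by (simp add: semi_conic_def)
  then have "\<And>S T. S \<in> \<S> \<Longrightarrow> l S < 0 \<Longrightarrow> T \<in> \<S> \<Longrightarrow> l T < 0 \<Longrightarrow> S = T"
    by (subst (asm) card_le_Suc0_iff_eq) auto
  then obtain T where "\<And>S. S \<in> \<S> \<Longrightarrow> S \<noteq> T \<Longrightarrow> 0 \<le> l S"
    by (metis not_less)
  moreover have "{} \<notin> \<S>" "UNIV \<notin> \<S>"
    using nt by (auto simp: nontrivial_system_def)
  ultimately show thesis
    using eq by (intro that[of T]) (auto simp: balanced_at_def sum_extend_by_zero)
qed

lemma balanced_at_restrict: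
  assumes l: "balanced_at T l r" and sub: "{S. l S \<noteq> 0} \<subseteq> \<S>"
  shows "semi_conic \<S> l" "(\<Sum>S\<in>\<S>. l S *\<^sub>R incidence S) = vec r"
    "(\<Sum>S\<in>\<S>. l S) = (\<Sum>S\<in>UNIV. l S)"
proof -
  have "{S \<in> \<S>. l S < 0} \<subseteq> {T}"
    using balanced_atD(3)[OF l] by force
  from card_mono[OF _ this] show "semi_conic \<S> l"
    by (simp add: semi_conic_def)
  show "(\<Sum>S\<in>\<S>. l S *\<^sub>R incidence S) = vec r"
    unfolding balanced_atD(4)[OF l, symmetric] using sub by (intro sum.mono_neutral_left) auto
  show "(\<Sum>S\<in>\<S>. l S) = (\<Sum>S\<in>UNIV. l S)"
    using sub by (intro sum.mono_neutral_left) auto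
qed

text \<open>This replaces systems by coefficient functions; non-triviality of the support comes from
  \<open>l\<close> vanishing at \<open>{}\<close> and \<open>UNIV\<close>.\<close>

lemma semi_balanced_iff_support:
  "semi_balanced \<S> \<longleftrightarrow> \<S> \<noteq> {} \<and> (\<exists>T l r. balanced_at T l r \<and> {S. l S \<noteq> 0} = \<S>)"
proof
  assume "semi_balanced \<S>"
  then obtain l r where nt: "nontrivial_system \<S>" and sc: "semi_conic \<S> l"
    and nz: "\<forall>S\<in>\<S>. l S \<noteq> 0" and eq: "(\<Sum>S\<in>\<S>. l S *\<^sub>R incidence S) = vec r"
    unfolding semi_balanced_def by blast
  obtain T where "balanced_at T (\<lambda>S. if S \<in> \<S> then l S else 0) r"
    using semi_conic_imp_balanced_at[OF nt sc eq] .
  moreover have "{S. (if S \<in> \<S> then l S else 0) \<noteq> 0} = \<S>"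
    using nz by auto
  ultimately show "\<S> \<noteq> {} \<and> (\<exists>T l r. balanced_at T l r \<and> {S. l S \<noteq> 0} = \<S>)"
    using nt unfolding nontrivial_system_def by blast
next
  assume "\<S> \<noteq> {} \<and> (\<exists>T l r. balanced_at T l r \<and> {S. l S \<noteq> 0} = \<S>)"
  then obtain T l r where l: "\<S> \<noteq> {}" "balanced_at T l r" "\<S> = {S. l S \<noteq> 0}"
    by blast
  with balanced_atD(1,2)[OF l(2)] have "nontrivial_system \<S>"
    by (auto simp: nontrivial_system_def)
  with l balanced_at_restrict(1,2)[OF l(2), of \<S>] show "semi_balanced \<S>"
    unfolding semi_balanced_def by blast
qed

text \<open>Zero coefficients are allowed in \<open>Theta\<close>, hence inclusion of the support in
  the system instead of equality.\<close>

lemma Theta_iff_balanced_at: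
  assumes nt: "nontrivial_system \<S>"
  shows "\<theta> \<in> Theta \<S> \<longleftrightarrow> (\<exists>T l r. balanced_at T l r \<and> {S. l S \<noteq> 0} \<subseteq> \<S> \<and>
    (\<Sum>S\<in>UNIV. l S) = 1 \<and> \<theta> = theta_vec \<S> l r)"
proof
  assume "\<theta> \<in> Theta \<S>"
  then obtain l r where \<theta>: "\<theta> = theta_vec \<S> l r" and af: "affine_coeffs \<S> l"
    and sc: "semi_conic \<S> l" and eq: "(\<Sum>S\<in>\<S>. l S *\<^sub>R incidence S) = vec r"
    by (auto simp: Theta_def)
  let ?l = "\<lambda>S. if S \<in> \<S> then l S else 0"
  obtain T where "balanced_at T ?l r"
    using semi_conic_imp_balanced_at[OF nt sc eq] .
  moreover have "(\<Sum>S\<in>UNIV. ?l S) = 1"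
    using af by (simp add: affine_coeffs_def sum.If_cases)
  moreover have "\<theta> = theta_vec \<S> ?l r"
    by (simp add: \<theta> theta_vec_def vec_eq_iff)
  moreover have "{S. ?l S \<noteq> 0} \<subseteq> \<S>"
    by auto
  ultimately show "\<exists>T l r. balanced_at T l r \<and> {S. l S \<noteq> 0} \<subseteq> \<S> \<and>
    (\<Sum>S\<in>UNIV. l S) = 1 \<and> \<theta> = theta_vec \<S> l r"
    by blast
next
  assume "\<exists>T l r. balanced_at T l r \<and> {S. l S \<noteq> 0} \<subseteq> \<S> \<and>
    (\<Sum>S\<in>UNIV. l S) = 1 \<and> \<theta> = theta_vec \<S> l r"
  then obtain T l r where l: "balanced_at T l r" "{S. l S \<noteq> 0} \<subseteq> \<S>" "(\<Sum>S\<in>UNIV. l S) = 1"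
    and \<theta>: "\<theta> = theta_vec \<S> l r"
    by blast
  show "\<theta> \<in> Theta \<S>"
    unfolding \<theta> Theta_def affine_coeffs_def
    using balanced_at_restrict[OF l(1,2)] l(3) by auto
qed

text \<open>The entry \<open>1 - r\<close> at the empty set is annihilated by
  \<open>m $ {} = 0\<close>.\<close>

lemma theta_vec_inner:
  fixes m :: "real ^ (('n::finite) set)"
  assumes nt: "nontrivial_system \<S>" and sub: "{S. l S \<noteq> 0} \<subseteq> \<S>" and m0: "m $ {} = 0"
  shows "theta_vec \<S> l r \<bullet> m = value_of m l r"
proof -
  have ne: "{} \<notin> \<S>" "UNIV \<notin> \<S>"
    using nt by (auto simp: nontrivial_system_def)
  have "theta_vec \<S> l r $ L * m $ L = (if L = UNIV then r * m $ UNIV else 0) - l L * m $ L" for L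
    using ne sub m0 by (auto simp: theta_vec_def)
  then show ?thesis
    by (simp add: inner_vec_def value_of_def sum_subtractf)
qed

text \<open>Reducing one affine combination by another shrinks the support, so by minimality the
  remainder is zero. The two are then proportional, and equal because both coefficient sums are
  1.\<close>

lemma min_semi_balanced_Theta:
  assumes mi: "min_semi_balanced \<S>" and l: "balanced_at T l r" "{S. l S \<noteq> 0} \<subseteq> \<S>"
    "(\<Sum>S\<in>UNIV. l S) = 1"
  shows "Theta \<S> = {theta_vec \<S> l r}"
proof -
  have nt: "nontrivial_system \<S>"
    using mi by (simp add: min_semi_balanced_def semi_balanced_def)
  \<comment> \<open>Minimality in terms of combinations: a non-zero one supported inside the system
    uses every member of it.\<close>
  have full: "{S. k S \<noteq> 0} = \<S>"
    if k: "balanced_at T' k r'" "{S. k S \<noteq> 0} \<subseteq> \<S>" "k S0 \<noteq> 0" for T' k r' S0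
  proof -
    have "semi_balanced {S. k S \<noteq> 0}"
      using k by (subst semi_balanced_iff_support) blast
    with mi k(2) show ?thesis
      unfolding min_semi_balanced_def by blast
  qed
  have nz: "\<exists>S. k S \<noteq> 0" if "(\<Sum>S\<in>UNIV. k S) = 1" for k :: "'a set \<Rightarrow> real"
    using that by (metis sum.not_neutral_contains_not_neutral zero_neq_one)
  have "\<theta> = theta_vec \<S> l r" if "\<theta> \<in> Theta \<S>" for \<theta>
  proof -
    from that obtain T' k r' where k: "balanced_at T' k r'" "{S. k S \<noteq> 0} \<subseteq> \<S>"
      "(\<Sum>S\<in>UNIV. k S) = 1" and \<theta>: "\<theta> = theta_vec \<S> k r'"
      by (auto simp: Theta_iff_balanced_at[OF nt])
    obtain S0 where S0: "k S0 \<noteq> 0"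
      using nz[OF k(3)] by blast
    have sl: "{S. l S \<noteq> 0} = \<S>"
      using nz[OF l(3)] full[OF l(1,2)] by blast
    have sub: "{S. k S \<noteq> 0} \<subseteq> {S. l S \<noteq> 0}"
      using k(2) sl by simp
    obtain t where t: "balanced_at T (\<lambda>S. l S - t * k S) (r - t * r')"
      "{S. l S - t * k S \<noteq> 0} \<subset> {S. l S \<noteq> 0}"
      by (rule balanced_at_reduce[OF l(1) k(1) sub S0])
    have eq: "l S = t * k S" for S
      using full[OF t(1), of S] t(2) sl by auto
    then have "t = 1"
      using l(3) k(3) by (simp add: sum_distrib_left[symmetric])
    with eq have "l = k"
      by auto
    moreover have "r = r'"
      using balanced_at_component[OF l(1)] balanced_at_component[OF k(1)] \<open>l = k\<close> by simp
    ultimately show ?thesis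
      by (simp add: \<theta>)
  qed
  moreover have "theta_vec \<S> l r \<in> Theta \<S>"
    using l by (auto simp: Theta_iff_balanced_at[OF nt])
  ultimately show ?thesis
    by blast
qed

section \<open>Both conditions on set systems as nonnegativity of \<open>value_of\<close>\<close>

lemma balanced_at_normalize:
  assumes "balanced_at T l r" "l S0 \<noteq> 0"
  obtains c where "0 < c" "balanced_at T (\<lambda>S. c * l S) (c * r)" "(\<Sum>S\<in>UNIV. c * l S) = 1"
    "{S. c * l S \<noteq> 0} = {S. l S \<noteq> 0}"
proof -
  define c where "c = 1 / (\<Sum>S\<in>UNIV. l S)"
  have "0 < (\<Sum>S\<in>UNIV. l S)"
    using assms by (rule balanced_at_sum_pos)
  then have "0 < c" "(\<Sum>S\<in>UNIV. c * l S) = 1"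
    by (auto simp: c_def sum_divide_distrib[symmetric])
  with balanced_at_scale[OF assms(1), of c] show thesis
    by (intro that[of c]) auto
qed

text \<open>A non-zero balanced combination, rescaled to coefficient sum 1, gives an element of
  \<open>Theta\<close> of its own support, and rescaling by a positive factor preserves the sign of
  the value. The zero combination has \<open>r = 0\<close> and value 0.\<close>

lemma semi_balanced_Theta_iff:
  fixes m :: "real ^ (('n::finite) set)"
  assumes m0: "m $ {} = 0"
  shows "(\<forall>\<S>. semi_balanced \<S> \<longrightarrow> (\<forall>\<theta>\<in>Theta \<S>. 0 \<le> \<theta> \<bullet> m)) \<longleftrightarrow>
    (\<forall>T l r. balanced_at T l r \<longrightarrow> 0 \<le> value_of m l r)"
proof (intro iffI allI impI ballI)
  fix \<S> :: "'n set set" and \<theta>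
  assume "\<forall>T l r. balanced_at T l r \<longrightarrow> 0 \<le> value_of m l r" "semi_balanced \<S>" "\<theta> \<in> Theta \<S>"
  then show "0 \<le> \<theta> \<bullet> m"
    using m0 by (auto simp: semi_balanced_def Theta_iff_balanced_at theta_vec_inner)
next
  fix T :: "'n set" and l r
  assume H: "\<forall>\<S>. semi_balanced \<S> \<longrightarrow> (\<forall>\<theta>\<in>Theta \<S>. 0 \<le> \<theta> \<bullet> m)" and l: "balanced_at T l r"
  show "0 \<le> value_of m l r"
  proof (cases "\<exists>S. l S \<noteq> 0")
    case True
    then obtain c where c: "0 < c" "balanced_at T (\<lambda>S. c * l S) (c * r)"
      "(\<Sum>S\<in>UNIV. c * l S) = 1" "{S. c * l S \<noteq> 0} = {S. l S \<noteq> 0}"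
      using balanced_at_normalize[OF l] by blast
    let ?S = "{S. l S \<noteq> 0}"
    have sb: "semi_balanced ?S"
      using l True by (subst semi_balanced_iff_support) blast
    then have nt: "nontrivial_system ?S"
      by (simp add: semi_balanced_def)
    have "theta_vec ?S (\<lambda>S. c * l S) (c * r) \<in> Theta ?S"
      using c by (subst Theta_iff_balanced_at[OF nt]) blast
    with H sb have "0 \<le> theta_vec ?S (\<lambda>S. c * l S) (c * r) \<bullet> m"
      by blast
    then have "0 \<le> value_of m (\<lambda>S. c * l S) (c * r)"
      using c(4) by (subst (asm) theta_vec_inner[OF nt _ m0]) auto
    with c(1) show ?thesis
      by (simp add: value_of_scale zero_le_mult_iff)
  next
    case False
    then have "r = 0"
      using balanced_at_component[OF l] by simp
    with False show ?thesis
      by (simp add: value_of_def)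
  qed
qed

text \<open>From minimal systems to all combinations by induction on the size of the support: a
  combination whose support is not minimal splits into two with smaller support.\<close>

lemma min_semi_balanced_theta_iff:
  fixes m :: "real ^ (('n::finite) set)"
  assumes m0: "m $ {} = 0"
  shows "(\<forall>\<S>. min_semi_balanced \<S> \<longrightarrow> 0 \<le> theta \<S> \<bullet> m) \<longleftrightarrow>
    (\<forall>T l r. balanced_at T l r \<longrightarrow> 0 \<le> value_of m l r)"
proof -
  \<comment> \<open>On a minimal support, \<open>theta\<close> is the vector of the normalized
    combination, by uniqueness; \<open>c\<close> is the normalizing factor.\<close>
  have th: "\<exists>c>0. theta {S. l S \<noteq> 0} \<bullet> m = c * value_of m l r"
    if l: "balanced_at T l r" and mi: "min_semi_balanced {S. l S \<noteq> 0}"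
    for T l r
  proof -
    have nt: "nontrivial_system {S. l S \<noteq> 0}"
      using mi by (simp add: min_semi_balanced_def semi_balanced_def)
    then obtain c where c: "0 < c" "balanced_at T (\<lambda>S. c * l S) (c * r)"
      "(\<Sum>S\<in>UNIV. c * l S) = 1" "{S. c * l S \<noteq> 0} = {S. l S \<noteq> 0}"
      using balanced_at_normalize[OF l] unfolding nontrivial_system_def by blast
    have "theta {S. l S \<noteq> 0} = theta_vec {S. l S \<noteq> 0} (\<lambda>S. c * l S) (c * r)"
      unfolding theta_def using min_semi_balanced_Theta[OF mi c(2) _ c(3)] c(4) by simp
    then have "theta {S. l S \<noteq> 0} \<bullet> m = value_of m (\<lambda>S. c * l S) (c * r)"
      using theta_vec_inner[OF nt _ m0] c(4) by simp
    with c(1) show ?thesis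
      by (auto simp: value_of_scale)
  qed
  show ?thesis
  proof (intro iffI allI impI)
    fix \<S> :: "'n set set"
    assume H: "\<forall>T l r. balanced_at T l r \<longrightarrow> 0 \<le> value_of m l r" and mi: "min_semi_balanced \<S>"
    then obtain T l r where l: "balanced_at T l r" "\<S> = {S. l S \<noteq> 0}"
      unfolding min_semi_balanced_def semi_balanced_iff_support by blast
    with th[OF l(1)] mi H show "0 \<le> theta \<S> \<bullet> m"
      by (metis less_imp_le mult_nonneg_nonneg)
  next
    fix T :: "'n set" and l r
    assume H: "\<forall>\<S>. min_semi_balanced \<S> \<longrightarrow> 0 \<le> theta \<S> \<bullet> m" and l: "balanced_at T l r"
    then show "0 \<le> value_of m l r"
    proof (induction "card {S. l S \<noteq> 0}" arbitrary: T l r rule: less_induct)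
      case less
      note l = less.prems(2)
      have IH: "0 \<le> value_of m k s"
        if "balanced_at U k s" "{S. k S \<noteq> 0} \<subset> {S. l S \<noteq> 0}" for U k s
        using that less.hyps[OF psubset_card_mono] H by simp
      show ?case
      proof (cases "\<exists>S. l S \<noteq> 0")
        case False
        then have "r = 0"
          using balanced_at_component[OF l] by simp
        with False show ?thesis
          by (simp add: value_of_def)
      next
        case True
        then have sb: "semi_balanced {S. l S \<noteq> 0}"
          using l by (subst semi_balanced_iff_support) blast
        show ?thesis
        proof (cases "min_semi_balanced {S. l S \<noteq> 0}")
          case True
          with th[OF l True] H show ?thesis
            by (metis zero_le_mult_iff not_less)
        next
          case False
          with sb obtain \<C> where "\<C> \<subset> {S. l S \<noteq> 0}" "semi_balanced \<C>"
            by (auto simp: min_semi_balanced_def)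
          then obtain U k s S0 where k: "balanced_at U k s" "k S0 \<noteq> 0"
            "{S. k S \<noteq> 0} \<subset> {S. l S \<noteq> 0}"
            unfolding semi_balanced_iff_support by blast
          obtain t where t: "0 < t" "balanced_at T (\<lambda>S. l S - t * k S) (r - t * s)"
            "{S. l S - t * k S \<noteq> 0} \<subset> {S. l S \<noteq> 0}"
            by (rule balanced_at_reduce[OF l k(1) psubset_imp_subset[OF k(3)] k(2)])
          \<comment> \<open>Both \<open>k\<close> and \<open>l - t * k\<close> have smaller support,
            and the value of \<open>l\<close> is that of \<open>l - t * k\<close> plus
            \<open>t\<close> times that of \<open>k\<close>.\<close>
          have "0 \<le> value_of m k s" "0 \<le> value_of m l r - t * value_of m k s"
            using IH[OF k(1,3)] IH[OF t(2,3)] by (auto simp: value_of_diff_scaled)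
          with t(1) show ?thesis
            by (smt (verit) mult_nonneg_nonneg)
        qed
      qed
    qed
  qed
qed

theorem corollary9:
  fixes m :: "real ^ (('n::finite) set)"
  assumes "CARD('n) \<ge> 2"
    and "m $ {} = 0"
  shows "(m \<in> exact_games \<longleftrightarrow> (\<forall>\<S>. semi_balanced \<S> \<longrightarrow> (\<forall>\<theta>\<in>Theta \<S>. \<theta> \<bullet> m \<ge> 0)))
       \<and> ((\<forall>\<S>. semi_balanced \<S> \<longrightarrow> (\<forall>\<theta>\<in>Theta \<S>. \<theta> \<bullet> m \<ge> 0))
            \<longleftrightarrow> (\<forall>\<S>. min_semi_balanced \<S> \<longrightarrow> theta \<S> \<bullet> m \<ge> 0))"
proof -
  have "m \<in> exact_games \<longleftrightarrow> (\<forall>T l r. balanced_at T l r \<longrightarrow> 0 \<le> value_of m l r)"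
    using exact_value_nonneg[of m] not_exact_value_neg[OF assms(2)] by (metis not_less)
  then show ?thesis
    using semi_balanced_Theta_iff[OF assms(2)] min_semi_balanced_theta_iff[OF assms(2)] by blast
qed

end
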